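(* Let $p\ge 2$, $d_1\ge\cdots\ge d_p>0$ and $c_1,\dots,c_p\ge 1$. Let $\phi:(0,\infty)\to\mathbb{R}$ satisfy $0\le\phi(w)/w\le t_0<1$ for every $w>0$. Then $\kappa(\hat\beta_\phi)\le\kappa(\hat\beta)$ for every $w>0$, i.e. with $t=\phi(w)/w$, $$\kappa(\hat\beta_\phi)=\frac{\max_i d_i(1-t/c_i)}{\min_i d_i(1-t/c_i)}\le\frac{d_1}{d_p}=\kappa(\hat\beta),$$ if either (i) $c_1\le c_2\le\cdots\le c_p$ and $$t_0\le\min_{i>k}\left(\frac{c_ic_k(d_1d_k-d_id_p)}{c_id_1d_k-c_kd_id_p}\right),$$ or (ii) $c_p>c_1\ge c_2\ge\cdots\ge c_{p-1}$ and $$t_0\le\min\left(\frac{c_1c_{p-1}(d_{p-1}-d_p)}{c_1d_{p-1}-c_{p-1}d_p},\ \frac{c_{p-1}c_p(d_1d_{p-1}-d_p^2)}{c_pd_1d_{p-1}-c_{p-1}d_p^2}\right).$$ (The denominators appearing in the condition used are assumed nonzero.)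
   Context: In the linear model $y=A\beta+\varepsilon$ with $A$ an $N\times p$ matrix of rank $p$, let $P$ be an orthogonal matrix with $P'(A'A)^{-1}P=D=\mathrm{diag}(d_1,\dots,d_p)$. The least squares estimator is $\hat\beta=(A'A)^{-1}A'y$. With $X=P'\hat\beta$, $S=(y-A\hat\beta)'(y-A\hat\beta)$, $C=\mathrm{diag}(c_1,\dots,c_p)$, $w=X'C^{-1}D^{-1}X/S$ and $t=\phi(w)/w$, the shrinkage estimator is $\hat\beta_\phi=P(I-tC^{-1})X=G^{-1}A'y$ with $G=P\,\mathrm{diag}\big(d_i^{-1}(1-t/c_i)^{-1}\big)P'$. The condition number of a matrix is $\kappa(H)=\|H\|\,\|H^{-1}\|$ with $\|\cdot\|$ the spectral norm; the condition number of an estimator of the form $H^{-1}A'y$ is $\kappa(H)$, so $\kappa(\hat\beta)=\kappa(A'A)=d_1/d_p$ and $\kappa(\hat\beta_\phi)=\kappa(G)$. *)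

theory Defs
  imports "HOL-Analysis.Analysis"
begin

definition diag_mat :: "('p::finite \<Rightarrow> real) \<Rightarrow> real^'p^'p" where
  "diag_mat v = (\<chi> i j. if i = j then v i else 0)"

(* onorm is the operator norm induced by the Euclidean norms, i.e. the spectral norm *)
definition spectral_norm :: "real^'p^'p \<Rightarrow> real" where
  "spectral_norm H = onorm ((*v) H)"

definition cond_num :: "real^'p^'p \<Rightarrow> real" where
  "cond_num H = spectral_norm H * spectral_norm (matrix_inv H)"

(* An estimator of the form H^{-1} A' y; its condition number is cond_num H. *)
definition estimator_form :: "real^'p^'n \<Rightarrow> real^'p^'p \<Rightarrow> real^'n \<Rightarrow> real^'p" where
  "estimator_form A H y = matrix_inv H *v (transpose A *v y)"

definition least_squares :: "real^'p^'n \<Rightarrow> real^'n \<Rightarrow> real^'p" where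
  "least_squares A y = matrix_inv (transpose A ** A) *v (transpose A *v y)"

definition X_stat :: "real^'p^'n \<Rightarrow> real^'p^'p \<Rightarrow> real^'n \<Rightarrow> real^'p" where
  "X_stat A P y = transpose P *v least_squares A y"

definition S_stat :: "real^'p^'n \<Rightarrow> real^'n \<Rightarrow> real" where
  "S_stat A y = (y - A *v least_squares A y) \<bullet> (y - A *v least_squares A y)"

(* If the residual sum of squares S is zero, w is undefined in the source; here it is 0,
   so that a hypothesis w > 0 entails S > 0. *)
definition w_stat ::
  "real^'p^'n \<Rightarrow> real^'p^'p \<Rightarrow> real^'p^'p \<Rightarrow> real^'p^'p \<Rightarrow> real^'n \<Rightarrow> real" where
  "w_stat A P C D y =
     (X_stat A P y \<bullet> (matrix_inv C *v (matrix_inv D *v X_stat A P y))) / S_stat A y"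

definition shrink_factor :: "(real \<Rightarrow> real) \<Rightarrow> real \<Rightarrow> real" where
  "shrink_factor \<phi> w = \<phi> w / w"

definition shrinkage_estimator ::
  "real^'p^'n \<Rightarrow> real^'p^'p \<Rightarrow> real^'p^'p \<Rightarrow> real^'p^'p \<Rightarrow> (real \<Rightarrow> real) \<Rightarrow> real^'n \<Rightarrow> real^'p" where
  "shrinkage_estimator A P C D \<phi> y =
     P *v ((mat 1 - shrink_factor \<phi> (w_stat A P C D y) *\<^sub>R matrix_inv C) *v X_stat A P y)"

definition G_mat :: "real^'p^'p \<Rightarrow> ('p \<Rightarrow> real) \<Rightarrow> ('p \<Rightarrow> real) \<Rightarrow> real \<Rightarrow> real^'p^'p" where
  "G_mat P d c t =
     P ** diag_mat (\<lambda>i. inverse (d i) * inverse (1 - t / c i)) ** transpose P"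

end

theory Submission
  imports Defs
begin

text \<open>Both \<open>A'A\<close> and \<open>G\<close> are of the form \<open>P diag(1/g) P'\<close> with \<open>P\<close> orthogonal and \<open>g > 0\<close> (for \<open>A'A\<close>
  take \<open>t = 0\<close> in \<open>G\<close>), so their condition numbers are \<open>max g / min g\<close>. It remains to show
  \<open>d_p d_i (1 - t/c_i) \<le> d_1 d_k (1 - t/c_k)\<close> for all \<open>i\<close>, \<open>k\<close>. In case (i) this is monotonicity
  for \<open>i \<le> k\<close>, and for \<open>i > k\<close> it is the bound on \<open>t_0\<close> after clearing a positive denominator.
  In case (ii) \<open>d_i (1 - t/c_i)\<close> decreases for \<open>i < p\<close>, so only the pairs drawn from
  \<open>1\<close>, \<open>p - 1\<close>, \<open>p\<close> matter.\<close>

section \<open>Inverses of diagonal matrices and of their orthogonal conjugates\<close>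

lemma matrix_inv_eqI:
  fixes A B :: "real^'n^'n"
  assumes "A ** B = mat 1"
  shows "matrix_inv A = B"
proof -
  have BA: "B ** A = mat 1"
    using assms matrix_left_right_inverse by blast
  have "A ** matrix_inv A = mat 1 \<and> matrix_inv A ** A = mat 1"
    unfolding matrix_inv_def by (rule someI[of _ B]) (simp add: assms BA)
  then show ?thesis
    by (metis BA matrix_mul_assoc matrix_mul_lid matrix_mul_rid)
qed

lemma matrix_mul_inv_right:
  fixes A :: "real^'n^'n"
  assumes "invertible A"
  shows "A ** matrix_inv A = mat 1"
  using assms matrix_inv_eqI unfolding invertible_def by metis

lemma diag_mat_1: "diag_mat (\<lambda>i. 1) = mat 1"
  by (simp add: diag_mat_def mat_def)

lemma diag_mat_vec_nth: "(diag_mat v *v x) $ i = v i * x $ i"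
  by (simp add: diag_mat_def matrix_vector_mult_def if_distrib[of "\<lambda>a. a * _"] cong: if_cong)

lemma diag_mat_mult: "diag_mat u ** diag_mat v = diag_mat (\<lambda>i. u i * v i)"
  by (simp add: matrix_eq vec_eq_iff diag_mat_vec_nth mult.assoc flip: matrix_vector_mul_assoc)

lemma matrix_inv_diag_mat:
  assumes "\<And>i. v i \<noteq> 0"
  shows "matrix_inv (diag_mat v) = diag_mat (\<lambda>i. inverse (v i))"
  using assms by (intro matrix_inv_eqI) (simp add: diag_mat_mult diag_mat_1)

lemma norm_orthogonal_matrix_mult:
  fixes P :: "real^'n^'n"
  assumes "orthogonal_matrix P"
  shows "norm (P *v x) = norm x"
  using assms orthogonal_transformation_matrix[of "(*v) P"] orthogonal_transformation_norm
  by (simp add: matrix_of_matrix_vector_mul)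

text \<open>The inner factor \<open>transpose P ** P\<close> collapses to the identity, so
  conjugation by \<open>P\<close> is multiplicative and products of such matrices reduce to products
  of diagonals.\<close>

lemma orthogonal_conj_mult:
  fixes P :: "real^'n^'n"
  assumes "orthogonal_matrix P"
  shows "(P ** M ** transpose P) ** (P ** N ** transpose P) = P ** (M ** N) ** transpose P"
proof -
  have "(P ** M ** transpose P) ** (P ** N ** transpose P)
      = P ** (M ** (transpose P ** P) ** N) ** transpose P"
    by (simp only: matrix_mul_assoc)
  then show ?thesis
    using assms unfolding orthogonal_matrix_def by simp
qed

lemma orthogonal_conj_diag_inverse:
  fixes P :: "real^'n^'n"
  assumes "orthogonal_matrix P" and "\<And>i. v i \<noteq> 0"
  shows "(P ** diag_mat v ** transpose P)
         ** (P ** diag_mat (\<lambda>i. inverse (v i)) ** transpose P) = mat 1"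
  using assms by (simp add: orthogonal_conj_mult diag_mat_mult diag_mat_1 orthogonal_matrix_def)

section \<open>Spectral norm and condition number of orthogonally diagonalised matrices\<close>

lemma norm_diag_mat_le:
  fixes v :: "'n::finite \<Rightarrow> real"
  assumes "\<And>i. \<bar>v i\<bar> \<le> b"
  shows "norm (diag_mat v *v x) \<le> b * norm x"
proof -
  have b: "0 \<le> b"
    using assms abs_ge_zero order_trans by blast
  have "norm (diag_mat v *v x) \<le> norm (b *\<^sub>R x)"
    using assms b by (intro norm_le_componentwise_cart)
      (auto simp: diag_mat_vec_nth abs_mult intro!: mult_right_mono)
  then show ?thesis
    using b by simp
qed

text \<open>Orthogonal factors preserve the Euclidean norm, so only the diagonal matters for the
  upper bound. Column \<open>j\<close> of \<open>P\<close> is a unit eigenvector with eigenvalue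
  \<open>v j\<close>, so the bound is attained.\<close>

lemma spectral_norm_orthogonal_conj_diag:
  fixes P :: "real^'n^'n"
  assumes P: "orthogonal_matrix P" and pos: "\<And>i. v i > 0"
  shows "spectral_norm (P ** diag_mat v ** transpose P) = Max (range v)"
proof (rule antisym)
  let ?H = "P ** diag_mat v ** transpose P"
  have nrm: "norm (?H *v x) = norm (diag_mat v *v (transpose P *v x))" for x
    using P by (simp add: norm_orthogonal_matrix_mult flip: matrix_vector_mul_assoc)
  show "spectral_norm ?H \<le> Max (range v)"
    unfolding spectral_norm_def
  proof (rule onorm_le)
    fix x
    have "norm (diag_mat v *v (transpose P *v x)) \<le> Max (range v) * norm (transpose P *v x)"
      using pos by (intro norm_diag_mat_le) (simp add: abs_of_pos)
    then show "norm (?H *v x) \<le> Max (range v) * norm x"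
      using P by (simp only: nrm norm_orthogonal_matrix_mult orthogonal_matrix_transpose)
  qed
  have "v j \<le> spectral_norm ?H" for j
  proof -
    let ?x = "P *v axis j 1"
    have "transpose P *v ?x = axis j 1"
      using P by (simp add: matrix_vector_mul_assoc orthogonal_matrix_def)
    moreover have "diag_mat v *v axis j 1 = v j *\<^sub>R axis j 1"
      by (simp add: vec_eq_iff diag_mat_vec_nth axis_def)
    ultimately have "norm (?H *v ?x) = v j"
      using pos[of j] by (simp add: nrm)
    moreover have "norm ?x = 1"
      using P by (simp add: norm_orthogonal_matrix_mult)
    ultimately show ?thesis
      using onorm[of "(*v) ?H" ?x] by (simp add: spectral_norm_def)
  qed
  then show "Max (range v) \<le> spectral_norm ?H"
    by simp
qed

lemma Max_inverse_eq_inverse_Min: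
  fixes g :: "'n::finite \<Rightarrow> real"
  assumes "\<And>i. g i > 0"
  shows "Max (range (\<lambda>i. inverse (g i))) = inverse (Min (range g))"
proof (rule Max_eqI)
  have "Min (range g) \<in> range g"
    by (rule Min_in) auto
  then obtain j where j: "Min (range g) = g j"
    by blast
  show "inverse (Min (range g)) \<in> range (\<lambda>i. inverse (g i))"
    by (simp add: j)
  show "y \<le> inverse (Min (range g))" if "y \<in> range (\<lambda>i. inverse (g i))" for y
    using that assms by (auto simp: j simp flip: j intro!: le_imp_inverse_le)
qed simp

text \<open>Inverting the matrix only replaces the diagonal \<open>1/g\<close> by \<open>g\<close>;
  the two spectral norms are then \<open>1 / Min g\<close> and \<open>Max g\<close>. The diagonal is
  written with reciprocals because both \<open>transpose A ** A\<close> and \<open>G\<close> arise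
  in this shape.\<close>

lemma cond_num_orthogonal_conj_diag:
  fixes P :: "real^'n^'n"
  assumes P: "orthogonal_matrix P" and pos: "\<And>i. g i > 0"
  shows "cond_num (P ** diag_mat (\<lambda>i. inverse (g i)) ** transpose P)
         = Max (range g) / Min (range g)"
proof -
  have "matrix_inv (P ** diag_mat (\<lambda>i. inverse (g i)) ** transpose P)
      = P ** diag_mat g ** transpose P"
    using orthogonal_conj_diag_inverse[OF P, of "\<lambda>i. inverse (g i)"] pos
    by (intro matrix_inv_eqI) (simp add: less_imp_neq[symmetric])
  then show ?thesis
    using P pos Max_inverse_eq_inverse_Min[of g]
    by (simp add: cond_num_def spectral_norm_orthogonal_conj_diag divide_inverse mult.commute)
qed

text \<open>The squared norm of \<open>A *v x\<close> is the quadratic form of the Gram matrix at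
  \<open>x\<close>, so the Gram matrix and \<open>A\<close> have the same kernel, which is trivial
  at full column rank.\<close>

lemma invertible_gram:
  fixes A :: "real^'p^'n"
  assumes "rank A = CARD('p)"
  shows "invertible (transpose A ** A)"
proof -
  have "x = 0" if "(transpose A ** A) *v x = 0" for x
  proof -
    have "(A *v x) \<bullet> (A *v x) = (transpose A *v (A *v x)) \<bullet> x"
      by (simp add: dot_lmul_matrix)
    then have "A *v x = 0"
      using that by (simp add: matrix_vector_mul_assoc)
    then show ?thesis
      using assms matrix_nonfull_linear_equations_eq by blast
  qed
  then show ?thesis
    using invertible_left_inverse matrix_left_invertible_ker by blast
qed

section \<open>Scalar inequalities for the diagonal entries d_i (1 - t/c_i)\<close>

lemma shrink_le_of_threshold:
  fixes x y a b t :: real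
  assumes ab: "0 < a" "a \<le> b" and xy: "0 \<le> y" "y \<le> x" and nz: "b * x - a * y \<noteq> 0"
    and t: "t \<le> (a * b * (x - y)) / (b * x - a * y)"
  shows "y * (1 - t / b) \<le> x * (1 - t / a)"
proof -
  \<comment> \<open>The orderings of \<open>a\<close>, \<open>b\<close> and of \<open>x\<close>,
    \<open>y\<close> already make the denominator nonnegative, so \<open>nz\<close> makes it
    positive and clearing it keeps the direction of the inequality.\<close>
  have "a * y \<le> b * x"
    using ab xy by (intro mult_mono) auto
  then have "b * x - a * y > 0"
    using nz by simp
  then have "t * (b * x - a * y) \<le> a * b * (x - y)"
    using t by (simp add: pos_le_divide_eq)
  \<comment> \<open>Scaled by \<open>a * b\<close>, both sides of the goal are affine in
    \<open>t\<close>, and their comparison is exactly the cleared threshold.\<close>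
  moreover have "a * b * (y * (1 - t / b)) = a * b * y - t * (a * y)"
    and "a * b * (x * (1 - t / a)) = a * b * x - t * (b * x)"
    using ab by (simp_all add: field_simps)
  ultimately have "a * b * (y * (1 - t / b)) \<le> a * b * (x * (1 - t / a))"
    by (simp add: right_diff_distrib)
  then show ?thesis
    using ab by (simp add: mult_le_cancel_left_pos)
qed

lemma shrink_mono:
  fixes a b t :: real
  assumes "0 \<le> t" "0 < a" "a \<le> b"
  shows "1 - t / a \<le> 1 - t / b"
  using assms by (simp add: frac_le)

text \<open>Case (i). The conclusion is the bound \<open>d 1 / d p\<close> on a quotient of two
  entries, cross-multiplied. If \<open>i \<le> k\<close>, both factors on the left are dominated; if
  \<open>i > k\<close>, the larger \<open>c i\<close> works against the inequality and the threshold
  for the pair compensates.\<close>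

lemma shrink_ratio_increasing:
  fixes c d :: "nat \<Rightarrow> real"
  assumes d_antimono: "antimono_on {1..p} d" and d_pos: "\<And>i. i \<in> {1..p} \<Longrightarrow> d i > 0"
    and c_ge_1: "\<And>i. i \<in> {1..p} \<Longrightarrow> c i \<ge> 1" and t: "0 \<le> t" "t < 1"
    and c_mono: "mono_on {1..p} c"
    and nz: "\<forall>i\<in>{1..p}. \<forall>k\<in>{1..p}. i > k \<longrightarrow> c i * d 1 * d k - c k * d i * d p \<noteq> 0"
    and thr: "t \<le> Min {(c i * c k * (d 1 * d k - d i * d p)) / (c i * d 1 * d k - c k * d i * d p)
                   | i k. i \<in> {1..p} \<and> k \<in> {1..p} \<and> i > k}" (is "t \<le> Min ?S")
    and ik: "i \<in> {1..p}" "k \<in> {1..p}"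
  shows "d p * (d i * (1 - t / c i)) \<le> d 1 * (d k * (1 - t / c k))"
proof -
  have p1: "1 \<in> {1..p}" "p \<in> {1..p}"
    using ik by auto
  have d_mono: "d j \<le> d l" if "l \<in> {1..p}" "j \<in> {1..p}" "l \<le> j" for l j
    using d_antimono that by (auto simp: monotone_on_def)
  \<comment> \<open>This holds whatever the order of \<open>i\<close> and \<open>k\<close>:
    \<open>d 1\<close> is the largest value and \<open>d p\<close> the smallest.\<close>
  have dd: "d i * d p \<le> d 1 * d k"
    using ik p1 d_pos[OF p1(1)] d_pos[OF p1(2)] by (intro mult_mono d_mono) auto
  show ?thesis
  proof (cases "i \<le> k")
    case True
    have "c i \<le> c k"
      using c_mono ik True by (auto simp: monotone_on_def)
    then have "1 - t / c i \<le> 1 - t / c k"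
      using t c_ge_1[OF ik(1)] by (intro shrink_mono) auto
    moreover have "0 \<le> 1 - t / c i"
      using t c_ge_1[OF ik(1)] by simp
    ultimately have "(d i * d p) * (1 - t / c i) \<le> (d 1 * d k) * (1 - t / c k)"
      using dd d_pos[OF ik(2)] d_pos[OF p1(1)] by (intro mult_mono[of "d i * d p"]) auto
    then show ?thesis
      by (simp add: ac_simps)
  next
    case False
    \<comment> \<open>Finiteness is what lets the minimum bound each of its members.\<close>
    have "?S \<subseteq> (\<lambda>(i, k). (c i * c k * (d 1 * d k - d i * d p)) /
                 (c i * d 1 * d k - c k * d i * d p)) ` ({1..p} \<times> {1..p})"
      by auto
    then have "finite ?S"
      by (rule finite_subset) simp
    then have "t \<le> (c i * c k * (d 1 * d k - d i * d p)) / (c i * d 1 * d k - c k * d i * d p)"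
    proof (rule order_trans[OF thr Min_le])
      show "(c i * c k * (d 1 * d k - d i * d p)) / (c i * d 1 * d k - c k * d i * d p) \<in> ?S"
        using False ik by (intro CollectI exI[of _ i] exI[of _ k]) simp
    qed
    moreover have "c k \<le> c i"
      using c_mono ik False by (auto simp: monotone_on_def)
    moreover have "0 < c k"
      using c_ge_1[OF ik(2)] by simp
    moreover have "c i * d 1 * d k - c k * d i * d p \<noteq> 0"
      using nz ik False by simp
    moreover have "0 \<le> d i * d p"
      using d_pos ik p1 by (simp add: less_imp_le)
    ultimately have "(d i * d p) * (1 - t / c i) \<le> (d 1 * d k) * (1 - t / c k)"
      using dd by (intro shrink_le_of_threshold) (simp_all add: ac_simps)
    then show ?thesis
      by (simp add: ac_simps)
  qed
qed

text \<open>Case (ii). Among the indices below \<open>p\<close> the entry is largest at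
  \<open>1\<close> and smallest at \<open>p - 1\<close>; index \<open>p\<close> is treated
  separately. Four pairs remain, and the two thresholds settle those with \<open>p - 1\<close> in
  the denominator.\<close>

lemma shrink_ratio_last_largest:
  fixes c d :: "nat \<Rightarrow> real"
  assumes p2: "p \<ge> 2"
    and d_antimono: "antimono_on {1..p} d" and d_pos: "\<And>i. i \<in> {1..p} \<Longrightarrow> d i > 0"
    and c_ge_1: "\<And>i. i \<in> {1..p} \<Longrightarrow> c i \<ge> 1" and t: "0 \<le> t" "t < 1"
    and cp: "c p > c 1" and c_anti: "antimono_on {1..p - 1} c"
    and nz1: "c 1 * d (p - 1) - c (p - 1) * d p \<noteq> 0"
    and nz2: "c p * d 1 * d (p - 1) - c (p - 1) * (d p)\<^sup>2 \<noteq> 0"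
    and thr: "t \<le> min ((c 1 * c (p - 1) * (d (p - 1) - d p)) / (c 1 * d (p - 1) - c (p - 1) * d p))
                 ((c (p - 1) * c p * (d 1 * d (p - 1) - (d p)\<^sup>2))
                    / (c p * d 1 * d (p - 1) - c (p - 1) * (d p)\<^sup>2))"
    and ik: "i \<in> {1..p}" "k \<in> {1..p}"
  shows "d p * (d i * (1 - t / c i)) \<le> d 1 * (d k * (1 - t / c k))"
proof -
  let ?g = "\<lambda>i. d i * (1 - t / c i)" and ?q = "p - 1"
  \<comment> \<open>\<open>p \<ge> 2\<close> keeps the truncated difference \<open>p - 1\<close> a
    valid index; for \<open>p = 2\<close> it coincides with \<open>1\<close>.\<close>
  have mem: "1 \<in> {1..p}" "p \<in> {1..p}" "?q \<in> {1..p}" "1 \<in> {1..?q}" "?q \<in> {1..?q}"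
    using p2 by auto
  have d_mono: "d j \<le> d l" if "l \<in> {1..p}" "j \<in> {1..p}" "l \<le> j" for l j
    using d_antimono that by (auto simp: monotone_on_def)
  have c_mono: "c j \<le> c l" if "l \<in> {1..?q}" "j \<in> {1..?q}" "l \<le> j" for l j
    using c_anti that by (auto simp: monotone_on_def)
  have a_nonneg: "0 \<le> 1 - t / c j" if "j \<in> {1..p}" for j
    using t c_ge_1[OF that] by simp
  have g_mono: "?g j \<le> ?g l" if "l \<in> {1..?q}" "j \<in> {1..?q}" "l \<le> j" for l j
  proof -
    have lj: "l \<in> {1..p}" "j \<in> {1..p}"
      using that by auto
    have "1 - t / c j \<le> 1 - t / c l"
      using t c_ge_1[OF lj(2)] c_mono[OF that] by (intro shrink_mono) auto
    then show ?thesis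
      using d_mono[OF lj that(3)] d_pos[OF lj(1)] a_nonneg[OF lj(2)]
      by (intro mult_mono) auto
  qed
  have cq: "0 < c ?q" "c ?q \<le> c 1"
    using c_ge_1[OF mem(3)] c_mono[of 1 ?q] mem by auto
  have dq: "d p \<le> d ?q" "0 < d p" "0 < d 1" "d p \<le> d 1"
    using d_mono d_pos mem by auto
  \<comment> \<open>Pair \<open>1\<close> over \<open>p - 1\<close>: the common factor
    \<open>d 1\<close> is cancelled before the first threshold is applied and restored
    afterwards.\<close>
  have "d p * (1 - t / c 1) \<le> d ?q * (1 - t / c ?q)"
    using thr nz1 cq dq by (intro shrink_le_of_threshold) (simp_all add: ac_simps)
  then have "d 1 * (d p * (1 - t / c 1)) \<le> d 1 * (d ?q * (1 - t / c ?q))"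
    using dq by (intro mult_left_mono) auto
  then have first_pred: "d p * ?g 1 \<le> d 1 * ?g ?q"
    by (simp add: ac_simps)
  have "(d p)\<^sup>2 \<le> d 1 * d ?q"
    unfolding power2_eq_square using dq by (intro mult_mono) auto
  then have "(d p)\<^sup>2 * (1 - t / c p) \<le> (d 1 * d ?q) * (1 - t / c ?q)"
    using thr nz2 cq cp by (intro shrink_le_of_threshold) (simp_all add: ac_simps)
  then have last_pred: "d p * ?g p \<le> d 1 * ?g ?q"
    by (simp add: ac_simps power2_eq_square)
  \<comment> \<open>Pair \<open>1\<close> over \<open>p\<close>: here \<open>c 1 < c p\<close>
    suffices, by monotonicity.\<close>
  have "1 - t / c 1 \<le> 1 - t / c p"
    using t c_ge_1[OF mem(1)] cp by (intro shrink_mono) auto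
  then have "(d p * d 1) * (1 - t / c 1) \<le> (d p * d 1) * (1 - t / c p)"
    using dq by (intro mult_left_mono) auto
  then have first_last: "d p * ?g 1 \<le> d 1 * ?g p"
    by (simp add: ac_simps)
  have last_last: "d p * ?g p \<le> d 1 * ?g p"
    using dq a_nonneg[OF mem(2)] by (intro mult_right_mono) auto
  have init: "j \<in> {1..?q}" if "j \<in> {1..p}" "j \<noteq> p" for j
    using that by auto
  \<comment> \<open>An index other than \<open>p\<close> may be replaced by the extreme one,
    \<open>1\<close> for the numerator and \<open>p - 1\<close> for the denominator.\<close>
  have hi: "d p * ?g i \<le> d p * ?g 1" if "i \<noteq> p"
    using g_mono[OF mem(4) init[OF ik(1) that]] ik dq by simp
  have lo: "d 1 * ?g ?q \<le> d 1 * ?g k" if "k \<noteq> p"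
    using g_mono[OF init[OF ik(2) that] mem(5)] init[OF ik(2) that] dq by simp
  show ?thesis
    using first_pred last_pred first_last last_last hi lo by (smt (verit))
qed

section \<open>Condition numbers of the least squares and shrinkage estimators\<close>

theorem theorem3p1:
  fixes A :: "real^'p^'n" and P C D :: "real^'p^'p"
    and e :: "'p \<Rightarrow> nat" and p :: nat
    and d c :: "nat \<Rightarrow> real" and \<phi> :: "real \<Rightarrow> real" and t0 :: real
  assumes p_def: "p = CARD('p)" and "p \<ge> 2"
    (* e numbers the coordinates by 1, ..., p *)
    and e: "bij_betw e UNIV {1..p}"
    and rank: "rank A = p"
    and P: "orthogonal_matrix P"
    and D: "D = diag_mat (\<lambda>j. d (e j))"
    and C: "C = diag_mat (\<lambda>j. c (e j))"
    and PD: "transpose P ** matrix_inv (transpose A ** A) ** P = D"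
    and d_antimono: "antimono_on {1..p} d" and d_pos: "d p > 0"
    and c_ge_1: "\<forall>i\<in>{1..p}. c i \<ge> 1"
    and \<phi>: "\<forall>w>0. 0 \<le> shrink_factor \<phi> w \<and> shrink_factor \<phi> w \<le> t0" and t0: "t0 < 1"
    and cases:
      "(mono_on {1..p} c \<and>
        (\<forall>i\<in>{1..p}. \<forall>k\<in>{1..p}. i > k \<longrightarrow> c i * d 1 * d k - c k * d i * d p \<noteq> 0) \<and>
        t0 \<le> Min {(c i * c k * (d 1 * d k - d i * d p)) / (c i * d 1 * d k - c k * d i * d p)
                   | i k. i \<in> {1..p} \<and> k \<in> {1..p} \<and> i > k})
       \<or>
       (c p > c 1 \<and> antimono_on {1..p - 1} c \<and>
        c 1 * d (p - 1) - c (p - 1) * d p \<noteq> 0 \<and>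
        c p * d 1 * d (p - 1) - c (p - 1) * (d p)\<^sup>2 \<noteq> 0 \<and>
        t0 \<le> min ((c 1 * c (p - 1) * (d (p - 1) - d p)) / (c 1 * d (p - 1) - c (p - 1) * d p))
                 ((c (p - 1) * c p * (d 1 * d (p - 1) - (d p)\<^sup>2))
                    / (c p * d 1 * d (p - 1) - c (p - 1) * (d p)\<^sup>2)))"
  shows
    (* both estimators have the form H^{-1} A' y, with H = A'A and H = G respectively *)
    "(\<forall>y. least_squares A y = estimator_form A (transpose A ** A) y) \<and>
     (\<forall>y. w_stat A P C D y > 0 \<longrightarrow>
        shrinkage_estimator A P C D \<phi> y =
        estimator_form A
          (G_mat P (\<lambda>j. d (e j)) (\<lambda>j. c (e j)) (shrink_factor \<phi> (w_stat A P C D y))) y) \<and>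
     invertible (transpose A ** A) \<and>
     (\<forall>w>0. let t = shrink_factor \<phi> w; G = G_mat P (\<lambda>j. d (e j)) (\<lambda>j. c (e j)) t in
        invertible G \<and>
        cond_num G = (MAX i\<in>{1..p}. d i * (1 - t / c i)) / (MIN i\<in>{1..p}. d i * (1 - t / c i)) \<and>
        cond_num G \<le> cond_num (transpose A ** A) \<and>
        cond_num (transpose A ** A) = d 1 / d p)"
proof -
  let ?dv = "\<lambda>j. d (e j)" and ?cv = "\<lambda>j. c (e j)"
  have e_in: "e j \<in> {1..p}" for j
    using e by (auto simp: bij_betw_def)
  \<comment> \<open>This carries extrema over the coordinate type to extrema over
    \<open>{1..p}\<close>.\<close>
  have range_e: "range (\<lambda>j. f (e j)) = f ` {1..p}" for f :: "nat \<Rightarrow> real"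
    using e unfolding bij_betw_def by (metis image_image)
  have mem: "1 \<in> {1..p}" "p \<in> {1..p}"
    using \<open>p \<ge> 2\<close> by auto
  have d_mono: "d j \<le> d l" if "l \<in> {1..p}" "j \<in> {1..p}" "l \<le> j" for l j
    using d_antimono that by (auto simp: monotone_on_def)
  have d_pos': "0 < d i" if "i \<in> {1..p}" for i
    using d_mono[OF that mem(2)] that d_pos by simp
  have c_ge_1': "1 \<le> c i" if "i \<in> {1..p}" for i
    using c_ge_1 that by blast
  have c_nz: "?cv j \<noteq> 0" for j
    using c_ge_1'[OF e_in] by (metis not_one_le_zero)

  have inv: "invertible (transpose A ** A)"
    using rank p_def by (simp add: invertible_gram)
  let ?M = "matrix_inv (transpose A ** A)"
  have PP: "P ** transpose P = mat 1" "transpose P ** P = mat 1"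
    using P by (auto simp: orthogonal_matrix_def)
  \<comment> \<open>\<open>PD\<close> is solved for the inverse Gram matrix; inverting the resulting
    diagonalisation then gives \<open>transpose A ** A\<close> itself.\<close>
  have "P ** D ** transpose P = (P ** transpose P) ** ?M ** (P ** transpose P)"
    by (simp only: PD[symmetric] matrix_mul_assoc)
  then have M: "?M = P ** diag_mat ?dv ** transpose P"
    by (simp add: PP D)
  have "?M ** (P ** diag_mat (\<lambda>j. inverse (?dv j)) ** transpose P) = mat 1"
    unfolding M using P d_pos'[OF e_in]
    by (intro orthogonal_conj_diag_inverse) (auto simp: less_imp_neq[symmetric])
  then have gram: "transpose A ** A = P ** diag_mat (\<lambda>j. inverse (?dv j)) ** transpose P"
    by (metis inv matrix_mul_assoc matrix_mul_inv_right matrix_mul_lid matrix_mul_rid)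
  have d_extremes: "Max (d ` {1..p}) = d 1" "Min (d ` {1..p}) = d p"
    using mem by (auto intro!: Max_eqI Min_eqI d_mono)
  have cond_gram: "cond_num (transpose A ** A) = d 1 / d p"
    unfolding gram using P d_pos'[OF e_in] d_extremes range_e[of d]
    by (subst cond_num_orthogonal_conj_diag) simp_all

  let ?g = "\<lambda>t i. d i * (1 - t / c i)"
  have G_eq: "G_mat P ?dv ?cv t = P ** diag_mat (\<lambda>j. inverse (?g t (e j))) ** transpose P" for t
    by (simp add: G_mat_def)
  have t_bounds: "0 \<le> shrink_factor \<phi> w" "shrink_factor \<phi> w \<le> t0" "shrink_factor \<phi> w < 1"
    if "w > 0" for w
    using \<phi> t0 that by force+
  \<comment> \<open>Positivity comes from \<open>t < 1 \<le> c i\<close>.\<close>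
  have g_pos: "?g (shrink_factor \<phi> w) i > 0" if "w > 0" "i \<in> {1..p}" for w i
    using t_bounds[OF that(1)] c_ge_1'[OF that(2)] d_pos'[OF that(2)] by simp
  have G_inv: "G_mat P ?dv ?cv (shrink_factor \<phi> w)
      ** (P ** diag_mat (\<lambda>j. ?g (shrink_factor \<phi> w) (e j)) ** transpose P) = mat 1"
    if "w > 0" for w
    using orthogonal_conj_diag_inverse[OF P, of "\<lambda>j. inverse (?g (shrink_factor \<phi> w) (e j))"]
      g_pos[OF that e_in]
    unfolding G_eq by (simp only: inverse_inverse_eq) (metis less_irrefl inverse_zero_imp_zero)

  have estimator: "shrinkage_estimator A P C D \<phi> y =
      estimator_form A (G_mat P ?dv ?cv (shrink_factor \<phi> (w_stat A P C D y))) y"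
    if w: "w_stat A P C D y > 0" for y
  proof -
    define t where "t = shrink_factor \<phi> (w_stat A P C D y)"
    have "mat 1 - t *\<^sub>R matrix_inv C = diag_mat (\<lambda>j. 1 - t / ?cv j)"
      unfolding C using c_nz
      by (subst matrix_inv_diag_mat)
        (auto simp: diag_mat_def mat_def vec_eq_iff divide_inverse)
    then have shrink: "(mat 1 - t *\<^sub>R matrix_inv C) ** diag_mat ?dv = diag_mat (\<lambda>j. ?g t (e j))"
      by (simp add: diag_mat_mult mult.commute)
    \<comment> \<open>The factor \<open>transpose P\<close> in \<open>X_stat\<close> meets the
      leading \<open>P\<close> of the diagonalised inverse Gram matrix; once they cancel, the two
      diagonals multiply to that of the inverse of \<open>G\<close>.\<close>
    have "shrinkage_estimator A P C D \<phi> y =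
      (P ** (mat 1 - t *\<^sub>R matrix_inv C) ** (transpose P ** P) ** diag_mat ?dv ** transpose P)
        *v (transpose A *v y)"
      unfolding shrinkage_estimator_def X_stat_def least_squares_def M t_def
      by (simp only: matrix_vector_mul_assoc matrix_mul_assoc)
    also have "\<dots> = (P ** ((mat 1 - t *\<^sub>R matrix_inv C) ** diag_mat ?dv) ** transpose P)
        *v (transpose A *v y)"
      by (simp add: PP matrix_mul_assoc)
    also have "\<dots> = estimator_form A (G_mat P ?dv ?cv t) y"
      unfolding estimator_form_def shrink matrix_inv_eqI[OF G_inv[OF w], folded t_def] ..
    finally show ?thesis
      by (simp add: t_def)
  qed

  have main: "invertible (G_mat P ?dv ?cv t) \<and>
        cond_num (G_mat P ?dv ?cv t) = (MAX i\<in>{1..p}. ?g t i) / (MIN i\<in>{1..p}. ?g t i) \<and>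
        cond_num (G_mat P ?dv ?cv t) \<le> d 1 / d p"
    if w: "w > 0" and t_def: "t = shrink_factor \<phi> w" for w t
  proof (intro conjI)
    show "invertible (G_mat P ?dv ?cv t)"
      using G_inv[OF w] invertible_right_inverse t_def by blast
    show cond: "cond_num (G_mat P ?dv ?cv t)
        = (MAX i\<in>{1..p}. ?g t i) / (MIN i\<in>{1..p}. ?g t i)"
      unfolding G_eq using P g_pos[OF w e_in] range_e[of "?g t"]
      by (subst cond_num_orthogonal_conj_diag) (simp_all add: t_def)
    \<comment> \<open>Both extrema are attained, so the bound on their quotient reduces to the
      cross-multiplied inequality for one pair \<open>i\<close>, \<open>k\<close>.\<close>
    have "Max (?g t ` {1..p}) \<in> ?g t ` {1..p}" "Min (?g t ` {1..p}) \<in> ?g t ` {1..p}"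
      using mem by (auto intro!: Max_in Min_in)
    then obtain i k where i: "i \<in> {1..p}" "Max (?g t ` {1..p}) = ?g t i"
      and k: "k \<in> {1..p}" "Min (?g t ` {1..p}) = ?g t k"
      by blast
    \<comment> \<open>The thresholds are imposed on \<open>t0\<close>; \<open>t \<le> t0\<close>
      passes them on to \<open>t\<close>.\<close>
    note t = t_bounds[OF w, folded t_def]
    from cases have ratio: "d p * ?g t i \<le> d 1 * ?g t k"
    proof (elim disjE conjE)
      assume "mono_on {1..p} c"
        and "\<forall>i\<in>{1..p}. \<forall>k\<in>{1..p}. i > k \<longrightarrow> c i * d 1 * d k - c k * d i * d p \<noteq> 0"
        and "t0 \<le> Min {(c i * c k * (d 1 * d k - d i * d p)) / (c i * d 1 * d k - c k * d i * d p)
                   | i k. i \<in> {1..p} \<and> k \<in> {1..p} \<and> i > k}"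
      then show ?thesis
        using order_trans[OF t(2)]
        by (intro shrink_ratio_increasing[OF d_antimono d_pos' c_ge_1' t(1,3) _ _ _ i(1) k(1)])
    next
      assume "c p > c 1" "antimono_on {1..p - 1} c"
        "c 1 * d (p - 1) - c (p - 1) * d p \<noteq> 0"
        "c p * d 1 * d (p - 1) - c (p - 1) * (d p)\<^sup>2 \<noteq> 0"
        "t0 \<le> min ((c 1 * c (p - 1) * (d (p - 1) - d p)) / (c 1 * d (p - 1) - c (p - 1) * d p))
                 ((c (p - 1) * c p * (d 1 * d (p - 1) - (d p)\<^sup>2))
                    / (c p * d 1 * d (p - 1) - c (p - 1) * (d p)\<^sup>2))"
      then show ?thesis
        using order_trans[OF t(2)]
        by (intro shrink_ratio_last_largest[OF \<open>p \<ge> 2\<close> d_antimono d_pos' c_ge_1' t(1,3)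
              _ _ _ _ _ i(1) k(1)])
    qed
    have "0 < ?g t k"
      using g_pos[OF w k(1)] by (simp only: t_def)
    moreover have "?g t i * d p \<le> d 1 * ?g t k"
      using ratio by (subst mult.commute)
    ultimately show "cond_num (G_mat P ?dv ?cv t) \<le> d 1 / d p"
      unfolding cond i k using d_pos
      by (simp only: pos_divide_le_eq times_divide_eq_left pos_le_divide_eq)
  qed
  show ?thesis
    unfolding Let_def cond_gram using estimator inv main[OF _ refl]
    by (auto simp only: least_squares_def estimator_form_def)
qed

end
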